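(* Consider the scheme (P)-(C) described in the context, with $r=s=\Delta x$, $r_1=2\epsilon\Delta t$, $r_2=2\Delta t$, $r_3=2\epsilon d\gamma\Delta t$. Assume that the discrete solution satisfies $u_{\mathbf j}^n>0$ for all $\mathbf j$ and some $n\ge0$. Then the corrector step (C) admits a positive solution at the next time step, i.e. $u_{\mathbf j}^{n+1}>0$ for all $\mathbf j$, under the time-step restriction (for all $\mathbf j$) $$\frac{\Delta t}{\Delta x}\max_{\alpha\in\{1,\dots,d\}}\left(\left|\mathbf q_{\mathbf j}^{*,\alpha}\right|+\left|\mathbf q_{\mathbf j-\mathbf e_\alpha}^{*,\alpha}\right|+\sqrt{2\left|\Pi_{\mathbf j+\mathbf e_\alpha}^*-2\Pi_{\mathbf j}^*+\Pi_{\mathbf j-\mathbf e_\alpha}^*\right|}\right)\le\frac1d\min\{1,u_{\mathbf j}^*\},$$ where $\mathbf q_{\mathbf j}^{*,\alpha}$ denotes the $\alpha$-th component of $\mathbf q_{\mathbf j}^*$.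
   Context: **Grid.** Fix $d,N\in\mathbb{N}$, $a<b$, $\Omega=(a,b)^d$ with periodic boundary conditions, $\Delta x=(b-a)/N$, time step $\Delta t>0$. Grid points are indexed by $\mathbf{j}=(j_1,\dots,j_d)$, $0\le j_\alpha\le N-1$, with indices understood periodically (mod $N$); $\mathbf{e}_\alpha$ is the unit multi-index in direction $\alpha$. For scalar grid functions $f$: $(D_\alpha^+f)_{\mathbf j}=(f_{\mathbf j+\mathbf e_\alpha}-f_{\mathbf j})/\Delta x$, $(D_\alpha^-f)_{\mathbf j}=(f_{\mathbf j}-f_{\mathbf j-\mathbf e_\alpha})/\Delta x$, $(\nabla_h^+f)_{\mathbf j}=((D_1^+f)_{\mathbf j},\dots,(D_d^+f)_{\mathbf j})$. For vector grid functions $\mathbf v=(v^1,\dots,v^d)$: $(\nabla_h^-\cdot\mathbf v)_{\mathbf j}=\sum_{\alpha=1}^d(D_\alpha^-v^\alpha)_{\mathbf j}$. $\Delta_h=\nabla_h^-\cdot\nabla_h^+$ on scalar grid functions, applied componentwise to vector grid functions. **Data.** $\epsilon\in(0,1]$, $\gamma>0$. Standing assumptions, with constants $L,m_0,\delta>0$: $\mathcal M:\mathbb R\to\mathbb R_+$ is $C^\infty$ with $\max_{\mathbb R}|\mathcal M'|<L$ and $\mathcal M(v)>1/m_0$ for $v\in[0,\infty)$; $\Pi:\mathbb R\to\mathbb R$ is $C^\infty$ with $\max_{\mathbb R}|\Pi'|,\max_{\mathbb R}|\Pi''|<L$ and $\Pi'(v)\ge\delta$ for $v\in[0,\infty)$.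 Notation: $\Pi^n_{\mathbf j}=\Pi(u^n_{\mathbf j})$, $\Pi^*_{\mathbf j}=\Pi(u^*_{\mathbf j})$, $\mathcal M^n_{\mathbf j}=\mathcal M(u^n_{\mathbf j})$. **Scheme.** $u,\psi,w$ are scalar and $\mathbf q,\mathbf p$ are $\mathbb R^d$-valued periodic grid functions, $\mathbf U=(u,\psi,\mathbf q,w,\mathbf p)$. Given $\mathbf U^n$, the intermediate state $\mathbf U^*=(u^*,\psi^*,\mathbf q^*,w^*,\mathbf p^* )$ solves, for all $\mathbf j$, (P) implicit predictor step: $$\frac{u^*_{\mathbf j}-u^n_{\mathbf j}}{\Delta t}=0,\qquad \frac{\psi^*_{\mathbf j}-\psi^n_{\mathbf j}}{\Delta t}=-\frac1\epsilon\big(w^*_{\mathbf j}+(1-\epsilon)(\nabla_h^-\cdot\mathbf q^* )_{\mathbf j}\big),$$ $$\frac{\mathbf q^*_{\mathbf j}-\mathbf q^n_{\mathbf j}}{\Delta t}=-\frac1\epsilon\Big(\frac{\mathbf q^*_{\mathbf j}}{\mathcal M^n_{\mathbf j}}+(1-\epsilon)(\nabla_h^+(\Pi^*+\psi^* ))_{\mathbf j}-r(\Delta_h\mathbf q^* )_{\mathbf j}\Big),$$ $$\frac{w^*_{\mathbf j}-w^n_{\mathbf j}}{\Delta t}=\frac1\epsilon\big(\psi^*_{\mathbf j}+\gamma(1-\epsilon)(\nabla_h^-\cdot\mathbf p^* )_{\mathbf j}+s(\Delta_hw^* )_{\mathbf j}\big),\qquad \frac{\mathbf p^*_{\mathbf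 j}-\mathbf p^n_{\mathbf j}}{\Delta t}=0;$$ (C) explicit corrector step: $$\frac{u^{n+1}_{\mathbf j}-u^*_{\mathbf j}}{\Delta t}+(\nabla_h^-\cdot\mathbf q^* )_{\mathbf j}=r_1(\Delta_h\Pi^* )_{\mathbf j},\qquad \frac{\psi^{n+1}_{\mathbf j}-\psi^*_{\mathbf j}}{\Delta t}+(\nabla_h^-\cdot\mathbf q^* )_{\mathbf j}=r_2(\Delta_h\psi^* )_{\mathbf j},$$ $$\frac{\mathbf q^{n+1}_{\mathbf j}-\mathbf q^*_{\mathbf j}}{\Delta t}+(\nabla_h^+(\Pi^*+\psi^* ))_{\mathbf j}=0,\qquad \frac{w^{n+1}_{\mathbf j}-w^*_{\mathbf j}}{\Delta t}-\gamma(\nabla_h^-\cdot\mathbf p^* )_{\mathbf j}=0,$$ $$\frac{\mathbf p^{n+1}_{\mathbf j}-\mathbf p^*_{\mathbf j}}{\Delta t}-(\nabla_h^+w^* )_{\mathbf j}=r_3(\Delta_h\mathbf p^* )_{\mathbf j}.$$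
   Formalization: Strict positivity at j is claimed only when the left side of the time-step restriction is strictly below u*_j/d; in the borderline case of equality with u*_j/d, where the value 0 can occur, only u^{n+1}_j ≥ 0 is claimed. *)

theory Defs
  imports "HOL-Analysis.Analysis"
begin

text \<open>The space dimension is \<open>d = CARD('d)\<close>. Grid functions are functions on all of
  \<open>int ^ 'd\<close> that are \<open>N\<close>-periodic in every direction; this encodes the multi-indices with
  entries in \<open>0, ..., N - 1\<close> read modulo \<open>N\<close>. The unit multi-index in direction \<open>\<alpha>\<close> is
  \<open>axis \<alpha> 1\<close>.\<close>

definition grid_periodic :: "nat \<Rightarrow> (int ^ 'd::finite \<Rightarrow> 'c) \<Rightarrow> bool" where
  "grid_periodic N f \<longleftrightarrow> (\<forall>j \<alpha>. f (j + axis \<alpha> (int N)) = f j)"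

definition D_plus :: "real \<Rightarrow> 'd::finite \<Rightarrow> (int ^ 'd \<Rightarrow> real) \<Rightarrow> int ^ 'd \<Rightarrow> real" where
  "D_plus dx \<alpha> f j = (f (j + axis \<alpha> 1) - f j) / dx"

definition D_minus :: "real \<Rightarrow> 'd::finite \<Rightarrow> (int ^ 'd \<Rightarrow> real) \<Rightarrow> int ^ 'd \<Rightarrow> real" where
  "D_minus dx \<alpha> f j = (f j - f (j - axis \<alpha> 1)) / dx"

definition grad_plus :: "real \<Rightarrow> (int ^ 'd::finite \<Rightarrow> real) \<Rightarrow> int ^ 'd \<Rightarrow> real ^ 'd" where
  "grad_plus dx f j = (\<chi> \<alpha>. D_plus dx \<alpha> f j)"

definition div_minus :: "real \<Rightarrow> (int ^ 'd::finite \<Rightarrow> real ^ 'd) \<Rightarrow> int ^ 'd \<Rightarrow> real" where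
  "div_minus dx v j = (\<Sum>\<alpha>\<in>UNIV. D_minus dx \<alpha> (\<lambda>i. v i $ \<alpha>) j)"

definition laplace_h :: "real \<Rightarrow> (int ^ 'd::finite \<Rightarrow> real) \<Rightarrow> int ^ 'd \<Rightarrow> real" where
  "laplace_h dx f = div_minus dx (grad_plus dx f)"

definition vec_laplace_h :: "real \<Rightarrow> (int ^ 'd::finite \<Rightarrow> real ^ 'd) \<Rightarrow> int ^ 'd \<Rightarrow> real ^ 'd" where
  "vec_laplace_h dx v j = (\<chi> \<alpha>. laplace_h dx (\<lambda>i. v i $ \<alpha>) j)"

datatype ('d::finite) state = State
  (u_of: "int ^ 'd \<Rightarrow> real")
  (psi_of: "int ^ 'd \<Rightarrow> real")
  (q_of: "int ^ 'd \<Rightarrow> real ^ 'd")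
  (w_of: "int ^ 'd \<Rightarrow> real")
  (p_of: "int ^ 'd \<Rightarrow> real ^ 'd")

definition grid_state :: "nat \<Rightarrow> 'd::finite state \<Rightarrow> bool" where
  "grid_state N U \<longleftrightarrow> grid_periodic N (u_of U) \<and> grid_periodic N (psi_of U) \<and>
     grid_periodic N (q_of U) \<and> grid_periodic N (w_of U) \<and> grid_periodic N (p_of U)"

definition C_infinity :: "(real \<Rightarrow> real) \<Rightarrow> bool" where
  "C_infinity f \<longleftrightarrow> (\<forall>k x. (deriv ^^ k) f field_differentiable at x)"

text \<open>The bound \<open>max \<bar>f\<bar> < L\<close> over the real line, with the maximum read as a finite supremum.\<close>

definition max_abs_less :: "(real \<Rightarrow> real) \<Rightarrow> real \<Rightarrow> bool" where
  "max_abs_less f L \<longleftrightarrow> bdd_above (range (\<lambda>v. \<bar>f v\<bar>)) \<and> (SUP v. \<bar>f v\<bar>) < L"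

definition mobility_assms :: "real \<Rightarrow> real \<Rightarrow> (real \<Rightarrow> real) \<Rightarrow> bool" where
  "mobility_assms L m0 M \<longleftrightarrow> C_infinity M \<and> (\<forall>v. 0 \<le> M v) \<and> max_abs_less (deriv M) L \<and>
     (\<forall>v\<ge>0. M v > 1 / m0)"

definition potential_assms :: "real \<Rightarrow> real \<Rightarrow> (real \<Rightarrow> real) \<Rightarrow> bool" where
  "potential_assms L \<delta> P \<longleftrightarrow> C_infinity P \<and> max_abs_less (deriv P) L \<and>
     max_abs_less (deriv (deriv P)) L \<and> (\<forall>v\<ge>0. deriv P v \<ge> \<delta>)"

text \<open>\<open>P\<close> stands for the function \<open>\<Pi>\<close>, \<open>U\<close> for the state at time level \<open>n\<close> and \<open>S\<close> for the
  intermediate (starred) state.\<close>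

definition predictor_step ::
  "real \<Rightarrow> real \<Rightarrow> real \<Rightarrow> real \<Rightarrow> real \<Rightarrow> real \<Rightarrow> (real \<Rightarrow> real) \<Rightarrow> (real \<Rightarrow> real) \<Rightarrow>
   'd::finite state \<Rightarrow> 'd state \<Rightarrow> bool" where
  "predictor_step dx dt \<epsilon> \<gamma> r s M P U S \<longleftrightarrow> (\<forall>j.
     (u_of S j - u_of U j) / dt = 0 \<and>
     (psi_of S j - psi_of U j) / dt
       = - (1 / \<epsilon>) * (w_of S j + (1 - \<epsilon>) * div_minus dx (q_of S) j) \<and>
     (q_of S j - q_of U j) /\<^sub>R dt
       = - (1 / \<epsilon>) *\<^sub>R (q_of S j /\<^sub>R M (u_of U j)
           + (1 - \<epsilon>) *\<^sub>R grad_plus dx (\<lambda>i. P (u_of S i) + psi_of S i) j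
           - r *\<^sub>R vec_laplace_h dx (q_of S) j) \<and>
     (w_of S j - w_of U j) / dt
       = (1 / \<epsilon>) * (psi_of S j + \<gamma> * (1 - \<epsilon>) * div_minus dx (p_of S) j
           + s * laplace_h dx (w_of S) j) \<and>
     (p_of S j - p_of U j) /\<^sub>R dt = 0)"

text \<open>\<open>V\<close> is the state at time level \<open>n + 1\<close>.\<close>

definition corrector_step ::
  "real \<Rightarrow> real \<Rightarrow> real \<Rightarrow> real \<Rightarrow> real \<Rightarrow> real \<Rightarrow> (real \<Rightarrow> real) \<Rightarrow>
   'd::finite state \<Rightarrow> 'd state \<Rightarrow> bool" where
  "corrector_step dx dt \<gamma> r1 r2 r3 P S V \<longleftrightarrow> (\<forall>j.
     (u_of V j - u_of S j) / dt + div_minus dx (q_of S) j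
       = r1 * laplace_h dx (\<lambda>i. P (u_of S i)) j \<and>
     (psi_of V j - psi_of S j) / dt + div_minus dx (q_of S) j
       = r2 * laplace_h dx (psi_of S) j \<and>
     (q_of V j - q_of S j) /\<^sub>R dt + grad_plus dx (\<lambda>i. P (u_of S i) + psi_of S i) j = 0 \<and>
     (w_of V j - w_of S j) / dt - \<gamma> * div_minus dx (p_of S) j = 0 \<and>
     (p_of V j - p_of S j) /\<^sub>R dt - grad_plus dx (w_of S) j
       = r3 *\<^sub>R vec_laplace_h dx (p_of S) j)"

definition cfl_lhs ::
  "real \<Rightarrow> real \<Rightarrow> (real \<Rightarrow> real) \<Rightarrow> 'd::finite state \<Rightarrow> int ^ 'd \<Rightarrow> real" where
  "cfl_lhs dx dt P S j = dt / dx *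
     (MAX \<alpha>\<in>UNIV. \<bar>q_of S j $ \<alpha>\<bar> + \<bar>q_of S (j - axis \<alpha> 1) $ \<alpha>\<bar>
        + sqrt (2 * \<bar>P (u_of S (j + axis \<alpha> 1)) - 2 * P (u_of S j)
                     + P (u_of S (j - axis \<alpha> 1))\<bar>))"

definition cfl_rhs :: "'d::finite state \<Rightarrow> int ^ 'd \<Rightarrow> real" where
  "cfl_rhs S j = 1 / real CARD('d) * min 1 (u_of S j)"

text \<open>The time-step restriction is \<open>cfl_lhs dx dt P S j \<le> cfl_rhs S j\<close> for all \<open>j\<close>. In the
  borderline case of equality with \<open>u_of S j \<le> 1\<close> the corrector can produce the value \<open>0\<close>: take
  \<open>d = 1\<close>, \<open>N = 2\<close>, \<open>u = 1\<close>, \<open>dt = dx = 1\<close> and \<open>q\<close> (starred) alternating between \<open>1/2\<close> and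
  \<open>-1/2\<close>. Strict positivity at \<open>j\<close> is therefore claimed only when \<open>cfl_lhs dx dt P S j\<close> is below
  \<open>u_of S j / d\<close>, which excludes exactly this case; nonnegativity is claimed always.\<close>

end

theory Submission
  imports Defs
begin

text \<open>The corrector is explicit: solving each equation for the new unknown gives a formula for the
  new state, which is periodic because all difference operators commute with translations. Hence
  there is exactly one new state (lemma \<open>corrector_step_iff\<close>).

  For positivity, put \<open>\<lambda> = dt / dx\<close> and, for a fixed grid point and direction \<open>\<alpha>\<close>, let
  \<open>a = \<bar>q j\<bar> + \<bar>q (j - e)\<bar>\<close> and let \<open>b\<close> be the modulus of the second difference of \<open>\<Pi>\<close>. The update
  removes at most \<open>\<lambda> a + 2 \<epsilon> \<lambda>\<^sup>2 b\<close> from the density in this direction. The second term is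
  \<open>\<epsilon> y\<^sup>2\<close> with \<open>y = \<lambda> sqrt (2 b)\<close>; this is where the square root in the time-step restriction and
  the choice \<open>2 \<epsilon> dt\<close> of the viscosity coefficient come from. The minimum with \<open>1\<close> in the restriction
  gives \<open>y \<le> 1\<close>, so \<open>\<epsilon> y\<^sup>2 \<le> y\<close>, and the loss per direction is at most
  \<open>\<lambda> (a + sqrt (2 b))\<close>, hence at most the left-hand side of the restriction. Summing over the \<open>d\<close>
  directions, the new density is at least the old one minus \<open>d\<close> times that left-hand side
  (lemma \<open>corrector_density_ge\<close>), uniformly in \<open>\<epsilon>\<close>. Both sign claims can be read off from this
  bound.\<close>

lemma grid_periodic_shift:
  assumes "grid_periodic N f"
  shows "grid_periodic N (\<lambda>j. f (j + k))" and "grid_periodic N (\<lambda>j. f (j - k))"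
proof -
  have "f (j + axis \<alpha> (int N) + k) = f (j + k)" for j \<alpha>
    using assms unfolding grid_periodic_def by (metis add.assoc add.commute)
  then show "grid_periodic N (\<lambda>j. f (j + k))"
    by (simp add: grid_periodic_def)
  have "f (j + axis \<alpha> (int N) - k) = f (j - k)" for j \<alpha>
    using assms unfolding grid_periodic_def by (metis diff_add_eq)
  then show "grid_periodic N (\<lambda>j. f (j - k))"
    by (simp add: grid_periodic_def)
qed

lemma grid_periodic_comp:
  assumes "grid_periodic N f"
  shows "grid_periodic N (\<lambda>j. h (f j))"
  using assms by (simp add: grid_periodic_def)

lemma grid_periodic_binop:
  assumes "grid_periodic N f" and "grid_periodic N g"
  shows "grid_periodic N (\<lambda>j. h (f j) (g j))"
  using assms by (simp add: grid_periodic_def)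

lemma grid_periodic_grad_plus:
  assumes "grid_periodic N f"
  shows "grid_periodic N (grad_plus dx f)"
  using assms grid_periodic_shift(1)[OF assms]
  by (simp add: grid_periodic_def grad_plus_def D_plus_def)

lemma grid_periodic_div_minus:
  assumes "grid_periodic N v"
  shows "grid_periodic N (div_minus dx v)"
  using assms grid_periodic_shift(2)[OF assms]
  by (simp add: grid_periodic_def div_minus_def D_minus_def)

lemma grid_periodic_laplace_h:
  assumes "grid_periodic N f"
  shows "grid_periodic N (laplace_h dx f)"
  unfolding laplace_h_def by (intro grid_periodic_div_minus grid_periodic_grad_plus assms)

lemma grid_periodic_vec_laplace_h:
  fixes v :: "int ^ 'd::finite \<Rightarrow> real ^ 'd"
  assumes "grid_periodic N v"
  shows "grid_periodic N (vec_laplace_h dx v)"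
proof -
  have "grid_periodic N (laplace_h dx (\<lambda>i. v i $ \<alpha>))" for \<alpha>
    by (rule grid_periodic_laplace_h[OF grid_periodic_comp[OF assms]])
  then show ?thesis
    by (simp add: grid_periodic_def vec_laplace_h_def)
qed

definition corrector_state ::
  "real \<Rightarrow> real \<Rightarrow> real \<Rightarrow> real \<Rightarrow> real \<Rightarrow> real \<Rightarrow> (real \<Rightarrow> real) \<Rightarrow> 'd::finite state \<Rightarrow> 'd state" where
  "corrector_state dx dt \<gamma> r1 r2 r3 P S = State
     (\<lambda>j. u_of S j + dt * (r1 * laplace_h dx (\<lambda>i. P (u_of S i)) j - div_minus dx (q_of S) j))
     (\<lambda>j. psi_of S j + dt * (r2 * laplace_h dx (psi_of S) j - div_minus dx (q_of S) j))
     (\<lambda>j. q_of S j - dt *\<^sub>R grad_plus dx (\<lambda>i. P (u_of S i) + psi_of S i) j)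
     (\<lambda>j. w_of S j + dt * (\<gamma> * div_minus dx (p_of S) j))
     (\<lambda>j. p_of S j + dt *\<^sub>R (r3 *\<^sub>R vec_laplace_h dx (p_of S) j + grad_plus dx (w_of S) j))"

lemma scaled_difference_eq_iff:
  fixes x y g h :: "'a::real_normed_vector"
  assumes "t \<noteq> 0"
  shows "(x - y) /\<^sub>R t + g = h \<longleftrightarrow> x = y + t *\<^sub>R (h - g)"
proof -
  have "(x - y) /\<^sub>R t + g = h \<longleftrightarrow> (x - y) /\<^sub>R t = h - g"
    by (simp add: eq_diff_eq)
  also have "\<dots> \<longleftrightarrow> h - g = (x - y) /\<^sub>R t"
    by (rule eq_commute)
  also have "\<dots> \<longleftrightarrow> t *\<^sub>R (h - g) = x - y"
    by (rule divideR_right[OF assms])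
  also have "\<dots> \<longleftrightarrow> t *\<^sub>R (h - g) + y = x"
    by (rule eq_diff_eq)
  also have "\<dots> \<longleftrightarrow> x = y + t *\<^sub>R (h - g)"
    by (simp only: add.commute[of y] eq_commute[of x])
  finally show ?thesis .
qed

lemma corrector_step_iff:
  fixes S V :: "'d::finite state"
  assumes "dt \<noteq> 0"
  shows "corrector_step dx dt \<gamma> r1 r2 r3 P S V \<longleftrightarrow> V = corrector_state dx dt \<gamma> r1 r2 r3 P S"
proof -
  have real_eq: "(x - y) / dt + g = h \<longleftrightarrow> x = y + dt * (h - g)" for x y g h :: real
    using scaled_difference_eq_iff[OF assms, of x y g h] by (simp add: divide_inverse mult.commute)
  have real_eq': "(x - y) / dt - g = 0 \<longleftrightarrow> x = y + dt * g" for x y g :: real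
    using real_eq[of x y "- g" 0] by simp
  have vec_eq: "(x - y) /\<^sub>R dt + g = 0 \<longleftrightarrow> x = y - dt *\<^sub>R g" for x y g :: "real ^ 'd"
    using scaled_difference_eq_iff[OF assms, of x y g 0] by simp
  have vec_eq': "(x - y) /\<^sub>R dt - g = h \<longleftrightarrow> x = y + dt *\<^sub>R (h + g)" for x y g h :: "real ^ 'd"
    using scaled_difference_eq_iff[OF assms, of x y "- g" h] by simp
  show ?thesis
    unfolding corrector_step_def corrector_state_def real_eq real_eq' vec_eq vec_eq'
    by (cases V) (auto simp: fun_eq_iff)
qed

lemma grid_state_corrector_state:
  assumes "grid_state N S"
  shows "grid_state N (corrector_state dx dt \<gamma> r1 r2 r3 P S)"
proof -
  have u: "grid_periodic N (u_of S)" and psi: "grid_periodic N (psi_of S)"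
    and q: "grid_periodic N (q_of S)" and w: "grid_periodic N (w_of S)"
    and p: "grid_periodic N (p_of S)"
    using assms by (simp_all add: grid_state_def)
  have P: "grid_periodic N (\<lambda>i. P (u_of S i))"
    by (rule grid_periodic_comp[OF u])
  note periodic = u psi q w p
    grid_periodic_laplace_h[OF P] grid_periodic_laplace_h[OF psi]
    grid_periodic_grad_plus[OF grid_periodic_binop[OF P psi, where h = "(+)"]]
    grid_periodic_grad_plus[OF w] grid_periodic_div_minus[OF q] grid_periodic_div_minus[OF p]
    grid_periodic_vec_laplace_h[OF p]
  show ?thesis
    using periodic by (simp add: grid_state_def corrector_state_def grid_periodic_def)
qed

lemma laplace_h_eq_sum:
  "laplace_h dx f j = (\<Sum>\<alpha>\<in>UNIV. (f (j + axis \<alpha> 1) - 2 * f j + f (j - axis \<alpha> 1)) / dx\<^sup>2)"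
proof -
  have "((x - y) / dx - (y - y') / dx) / dx = (x - 2 * y + y') / dx\<^sup>2" for x y y' :: real
    unfolding diff_divide_distrib[symmetric] by (simp add: power2_eq_square)
  then show ?thesis
    by (simp add: laplace_h_def div_minus_def D_minus_def grad_plus_def D_plus_def)
qed

text \<open>The loss in one direction, with \<open>c = q j\<close>, \<open>c' = q (j - e)\<close> and \<open>z\<close> the second difference
  of \<open>\<Pi>\<close>. Since \<open>2 \<lambda>\<^sup>2 \<bar>z\<bar>\<close> is the square of a number in the unit interval, it is bounded by that
  number.\<close>

lemma directional_loss_le:
  fixes lam \<epsilon> c c' z K :: real
  assumes "0 \<le> lam" "0 \<le> \<epsilon>" "\<epsilon> \<le> 1" "K \<le> 1"
    and K: "lam * (\<bar>c\<bar> + \<bar>c'\<bar> + sqrt (2 * \<bar>z\<bar>)) \<le> K"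
  shows "lam * (c - c') - 2 * \<epsilon> * lam\<^sup>2 * z \<le> K"
proof -
  define y where "y = lam * sqrt (2 * \<bar>z\<bar>)"
  have "0 \<le> y"
    using assms(1) by (simp add: y_def)
  have "0 \<le> lam * (\<bar>c\<bar> + \<bar>c'\<bar>)"
    using assms(1) by simp
  then have "y \<le> 1"
    using K assms(4) by (simp add: y_def distrib_left)
  have "- (2 * \<epsilon> * lam\<^sup>2 * z) \<le> \<epsilon> * (2 * lam\<^sup>2 * \<bar>z\<bar>)"
  proof -
    have "(2 * \<epsilon> * lam\<^sup>2) * (- z) \<le> (2 * \<epsilon> * lam\<^sup>2) * \<bar>z\<bar>"
      using assms(2) by (intro mult_left_mono) auto
    also have "\<dots> = \<epsilon> * (2 * lam\<^sup>2 * \<bar>z\<bar>)"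
      by (simp only: ac_simps)
    finally show ?thesis
      by (simp only: mult_minus_right)
  qed
  also have "2 * lam\<^sup>2 * \<bar>z\<bar> = y\<^sup>2"
    by (simp add: y_def power_mult_distrib)
  also have "\<epsilon> * y\<^sup>2 \<le> y\<^sup>2"
    using assms(2,3) by (simp add: mult_left_le_one_le)
  also have "\<dots> \<le> y"
    using \<open>0 \<le> y\<close> \<open>y \<le> 1\<close> by (simp add: power2_eq_square mult_left_le_one_le)
  finally have "- (2 * \<epsilon> * lam\<^sup>2 * z) \<le> y" .
  moreover have "lam * (c - c') \<le> lam * (\<bar>c\<bar> + \<bar>c'\<bar>)"
    using assms(1) by (intro mult_left_mono) auto
  ultimately show ?thesis
    using K by (simp add: y_def distrib_left)
qed

text \<open>Each of the \<open>d\<close> directions removes at most the maximum over all directions.\<close>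

lemma corrector_density_ge:
  fixes S V :: "'d::finite state"
  assumes "0 < dx" "0 < dt" "0 \<le> \<epsilon>" "\<epsilon> \<le> 1"
    and cfl: "cfl_lhs dx dt P S j \<le> 1"
    and step: "corrector_step dx dt \<gamma> (2 * \<epsilon> * dt) r2 r3 P S V"
  shows "u_of S j - real CARD('d) * cfl_lhs dx dt P S j \<le> u_of V j"
proof -
  define lam where "lam = dt / dx"
  define z where "z \<alpha> = P (u_of S (j + axis \<alpha> 1)) - 2 * P (u_of S j) + P (u_of S (j - axis \<alpha> 1))" for \<alpha>
  define loss where
    "loss \<alpha> = lam * (q_of S j $ \<alpha> - q_of S (j - axis \<alpha> 1) $ \<alpha>) - 2 * \<epsilon> * lam\<^sup>2 * z \<alpha>" for \<alpha>
  have "0 \<le> lam"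
    using assms(1,2) by (simp add: lam_def)
  have "u_of V j = u_of S j
      + dt * (2 * \<epsilon> * dt * laplace_h dx (\<lambda>i. P (u_of S i)) j - div_minus dx (q_of S) j)"
    using step assms(2) by (simp add: corrector_step_iff corrector_state_def)
  also have "dt * (2 * \<epsilon> * dt * laplace_h dx (\<lambda>i. P (u_of S i)) j - div_minus dx (q_of S) j)
      = (\<Sum>\<alpha>\<in>UNIV. - loss \<alpha>)"
    unfolding laplace_h_eq_sum div_minus_def D_minus_def z_def[symmetric] sum_distrib_left
      sum_subtractf[symmetric]
    by (intro sum.cong refl)
      (simp add: loss_def lam_def power2_eq_square right_diff_distrib diff_divide_distrib ac_simps)
  also have "u_of S j + \<dots> = u_of S j - (\<Sum>\<alpha>\<in>UNIV. loss \<alpha>)"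
    by (simp add: sum_negf)
  finally have update: "u_of V j = u_of S j - (\<Sum>\<alpha>\<in>UNIV. loss \<alpha>)" .
  have "loss \<alpha> \<le> cfl_lhs dx dt P S j" for \<alpha>
    unfolding loss_def
  proof (rule directional_loss_le[OF \<open>0 \<le> lam\<close> assms(3,4) cfl])
    show "lam * (\<bar>q_of S j $ \<alpha>\<bar> + \<bar>q_of S (j - axis \<alpha> 1) $ \<alpha>\<bar> + sqrt (2 * \<bar>z \<alpha>\<bar>))
        \<le> cfl_lhs dx dt P S j"
      unfolding cfl_lhs_def lam_def[symmetric] z_def
      by (intro mult_left_mono Max_ge \<open>0 \<le> lam\<close>) auto
  qed
  then have "(\<Sum>\<alpha>\<in>UNIV. loss \<alpha>) \<le> real CARD('d) * cfl_lhs dx dt P S j"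
    using sum_bounded_above[of UNIV loss "cfl_lhs dx dt P S j"] by simp
  with update show ?thesis
    by simp
qed

theorem lemma3p6:
  fixes a b dx dt \<epsilon> \<gamma> L m0 \<delta> :: real
    and N :: nat
    and M P :: "real \<Rightarrow> real"
    and U S :: "'d::finite state"
  assumes "a < b" and "0 < N" and "dx = (b - a) / real N" and "0 < dt"
    and "0 < \<epsilon>" and "\<epsilon> \<le> 1" and "0 < \<gamma>"
    and "0 < L" and "0 < m0" and "0 < \<delta>"
    and "mobility_assms L m0 M" and "potential_assms L \<delta> P"
    and "grid_state N U" and "grid_state N S"
    and "predictor_step dx dt \<epsilon> \<gamma> dx dx M P U S"
    and "\<forall>j. 0 < u_of U j"
    and "\<forall>j. cfl_lhs dx dt P S j \<le> cfl_rhs S j"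
  shows "(\<exists>!V. grid_state N V \<and>
            corrector_step dx dt \<gamma> (2 * \<epsilon> * dt) (2 * dt) (2 * \<epsilon> * real CARD('d) * \<gamma> * dt) P S V) \<and>
         (\<forall>V. grid_state N V \<and>
            corrector_step dx dt \<gamma> (2 * \<epsilon> * dt) (2 * dt) (2 * \<epsilon> * real CARD('d) * \<gamma> * dt) P S V \<longrightarrow>
            (\<forall>j. 0 \<le> u_of V j \<and>
               (cfl_lhs dx dt P S j < 1 / real CARD('d) * u_of S j \<longrightarrow> 0 < u_of V j)))"
proof (intro conjI allI impI)
  let ?step = "corrector_step dx dt \<gamma> (2 * \<epsilon> * dt) (2 * dt) (2 * \<epsilon> * real CARD('d) * \<gamma> * dt) P S"
  have "dt \<noteq> 0"
    using \<open>0 < dt\<close> by simp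
  show "\<exists>!V. grid_state N V \<and> ?step V"
    using grid_state_corrector_state[OF \<open>grid_state N S\<close>]
    by (auto simp: corrector_step_iff[OF \<open>dt \<noteq> 0\<close>])
  fix V j
  assume V: "grid_state N V \<and> ?step V"
  have "0 < dx"
    using \<open>a < b\<close> \<open>0 < N\<close> \<open>dx = (b - a) / real N\<close> by simp
  have d: "1 \<le> real CARD('d)"
    by (simp add: Suc_leI)
  have cfl: "cfl_lhs dx dt P S j \<le> 1 / real CARD('d) * min 1 (u_of S j)"
    using assms(17) by (simp add: cfl_rhs_def)
  have "1 / real CARD('d) * min 1 (u_of S j) \<le> 1 / real CARD('d) * 1"
    by (intro mult_left_mono) auto
  also have "\<dots> \<le> 1"
    using d by simp
  finally have "cfl_lhs dx dt P S j \<le> 1"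
    using cfl by linarith
  then have lower: "u_of S j - real CARD('d) * cfl_lhs dx dt P S j \<le> u_of V j"
    using V \<open>0 < dx\<close> \<open>0 < dt\<close> \<open>0 < \<epsilon>\<close> \<open>\<epsilon> \<le> 1\<close>
    by (intro corrector_density_ge[where \<epsilon> = \<epsilon>]) auto
  have "real CARD('d) * cfl_lhs dx dt P S j \<le> min 1 (u_of S j)"
    using cfl d by (simp add: field_simps)
  then show "0 \<le> u_of V j"
    using lower by simp
  assume "cfl_lhs dx dt P S j < 1 / real CARD('d) * u_of S j"
  then have "real CARD('d) * cfl_lhs dx dt P S j < u_of S j"
    using d by (simp add: field_simps)
  then show "0 < u_of V j"
    using lower by simp
qed

end
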